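(* Let $\{(x_i,y_i,d_i): i\in\mathbb{N}_N\}$ be a given positive data set, i.e. $y_i>0$ for all $i\in\mathbb{N}_N$. Suppose that for every $i\in\mathbb{N}_{N-1}$: (i) the scaling factor $\alpha_i$ is selected so that $$\alpha_i\in\Big[0,\ \min\Big\{a_i,\frac{y_i}{y_1},\frac{y_{i+1}}{y_N}\Big\}\Big);$$ (ii) the shape parameters $u_i$ and $v_i$ are restricted by $$u_i>0,\qquad v_i\ge\max\Big\{0,\ -u_i\Big[3+\frac{h_id_i-\alpha_i(x_N-x_1)d_1}{y_i-\alpha_iy_1}\Big],\ -u_i\Big[3+\frac{-h_id_{i+1}+\alpha_i(x_N-x_1)d_N}{y_{i+1}-\alpha_iy_N}\Big]\Big\}.$$ Then the corresponding rational cubic spline fractal interpolation function $\Psi$ is a positivity preserving $\mathcal{C}^1$-RCSFIF: $\Psi\in\mathcal{C}^1(I)$ and $\Psi(x)>0$ for all $x\in I$.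
   Context: Notation: $\mathbb{N}_r=\{1,2,\dots,r\}$; $N>2$; $x_1<x_2<\dots<x_N$ are real knots, $I=[x_1,x_N]$, $I_i=[x_i,x_{i+1}]$, $h_i=x_{i+1}-x_i$. The real numbers $y_i$ and $d_i$ are, respectively, the prescribed function value and derivative value at the knot $x_i$. For $i\in\mathbb{N}_{N-1}$, $L_i:I\to I_i$ is the affine map $L_i(x)=a_ix+b_i$ with $L_i(x_1)=x_i$, $L_i(x_N)=x_{i+1}$, so $a_i=\frac{x_{i+1}-x_i}{x_N-x_1}$ and $b_i=\frac{x_Nx_i-x_1x_{i+1}}{x_N-x_1}$. Rational cubic spline fractal interpolation function (RCSFIF): given scaling factors $\alpha_i$ with $|\alpha_i|<a_i$ and shape parameters $u_i>0$, $v_i\ge 0$ ($i\in\mathbb{N}_{N-1}$), the RCSFIF $\Psi$ corresponding to the data $\{(x_i,y_i,d_i)\}$ is the unique continuous function $\Psi:I\to\mathbb{R}$ with $\Psi(x_1)=y_1$, $\Psi(x_N)=y_N$ satisfying, for all $x\in I$ and all $i\in\mathbb{N}_{N-1}$, $$\Psi(L_i(x))=\alpha_i\Psi(x)+\frac{P_i^*(\theta)}{Q_i^*(\theta)},\qquad \theta=\frac{x-x_1}{x_N-x_1},$$ where $Q_i^*(\theta)=u_i+v_i\theta(1-\theta)$ and $P_i^*(\theta)=U_i(1-\theta)^3+V_i(1-\theta)^2\theta+W_i(1-\theta)\theta^2+Z_i\theta^3$ with $$U_i=u_i(y_i-\alpha_iy_1),\qquad Z_i=u_i(y_{i+1}-\alpha_iy_N),$$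 $$V_i=(3u_i+v_i)(y_i-\alpha_iy_1)+u_ih_id_i-\alpha_iu_i(x_N-x_1)d_1,$$ $$W_i=(3u_i+v_i)(y_{i+1}-\alpha_iy_N)-u_ih_id_{i+1}+\alpha_iu_i(x_N-x_1)d_N.$$ *)

theory Defs
  imports "HOL-Analysis.Analysis"
begin

definition aff_slope :: "nat \<Rightarrow> (nat \<Rightarrow> real) \<Rightarrow> nat \<Rightarrow> real" where
  "aff_slope N x i = (x (Suc i) - x i) / (x N - x 1)"

definition aff_shift :: "nat \<Rightarrow> (nat \<Rightarrow> real) \<Rightarrow> nat \<Rightarrow> real" where
  "aff_shift N x i = (x N * x i - x 1 * x (Suc i)) / (x N - x 1)"

definition aff_map :: "nat \<Rightarrow> (nat \<Rightarrow> real) \<Rightarrow> nat \<Rightarrow> real \<Rightarrow> real" where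
  "aff_map N x i t = aff_slope N x i * t + aff_shift N x i"

definition rc_den :: "(nat \<Rightarrow> real) \<Rightarrow> (nat \<Rightarrow> real) \<Rightarrow> nat \<Rightarrow> real \<Rightarrow> real" where
  "rc_den u v i \<theta> = u i + v i * \<theta> * (1 - \<theta>)"

definition rc_num ::
  "nat \<Rightarrow> (nat \<Rightarrow> real) \<Rightarrow> (nat \<Rightarrow> real) \<Rightarrow> (nat \<Rightarrow> real) \<Rightarrow>
   (nat \<Rightarrow> real) \<Rightarrow> (nat \<Rightarrow> real) \<Rightarrow> (nat \<Rightarrow> real) \<Rightarrow> nat \<Rightarrow> real \<Rightarrow> real" where
  "rc_num N x y d \<alpha> u v i \<theta> =
    (let h = x (Suc i) - x i;
         U = u i * (y i - \<alpha> i * y 1);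
         V = (3 * u i + v i) * (y i - \<alpha> i * y 1) + u i * h * d i
               - \<alpha> i * u i * (x N - x 1) * d 1;
         W = (3 * u i + v i) * (y (Suc i) - \<alpha> i * y N) - u i * h * d (Suc i)
               + \<alpha> i * u i * (x N - x 1) * d N;
         Z = u i * (y (Suc i) - \<alpha> i * y N)
     in U * (1 - \<theta>) ^ 3 + V * (1 - \<theta>)\<^sup>2 * \<theta> + W * (1 - \<theta>) * \<theta>\<^sup>2 + Z * \<theta> ^ 3)"

text \<open>The knots are \<open>x 1, \<dots>, x N\<close>; values of the data sequences at other indices play no role.\<close>

definition is_rcsfif ::
  "nat \<Rightarrow> (nat \<Rightarrow> real) \<Rightarrow> (nat \<Rightarrow> real) \<Rightarrow> (nat \<Rightarrow> real) \<Rightarrow>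
   (nat \<Rightarrow> real) \<Rightarrow> (nat \<Rightarrow> real) \<Rightarrow> (nat \<Rightarrow> real) \<Rightarrow> (real \<Rightarrow> real) \<Rightarrow> bool" where
  "is_rcsfif N x y d \<alpha> u v \<Psi> \<longleftrightarrow>
     (\<forall>i\<in>{1..N-1}. \<bar>\<alpha> i\<bar> < aff_slope N x i \<and> u i > 0 \<and> v i \<ge> 0) \<and>
     continuous_on {x 1..x N} \<Psi> \<and> \<Psi> (x 1) = y 1 \<and> \<Psi> (x N) = y N \<and>
     (\<forall>i\<in>{1..N-1}. \<forall>t\<in>{x 1..x N}.
        \<Psi> (aff_map N x i t) =
          \<alpha> i * \<Psi> t + (let \<theta> = (t - x 1) / (x N - x 1)
                      in rc_num N x y d \<alpha> u v i \<theta> / rc_den u v i \<theta>))"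

text \<open>A function on \<open>{x 1..x N}\<close> is represented by an extensional function on the reals, so that
  uniqueness on the interval is uniqueness of the HOL function.\<close>

definition rcsfif ::
  "nat \<Rightarrow> (nat \<Rightarrow> real) \<Rightarrow> (nat \<Rightarrow> real) \<Rightarrow> (nat \<Rightarrow> real) \<Rightarrow>
   (nat \<Rightarrow> real) \<Rightarrow> (nat \<Rightarrow> real) \<Rightarrow> (nat \<Rightarrow> real) \<Rightarrow> real \<Rightarrow> real" where
  "rcsfif N x y d \<alpha> u v =
     (THE \<Psi>. \<Psi> \<in> extensional {x 1..x N} \<and> is_rcsfif N x y d \<alpha> u v \<Psi>)"

text \<open>Derivatives are taken within \<open>S\<close>, hence one-sided at the end points of a closed interval.
  The library's \<open>C1_differentiable_on\<close> asks for two-sided derivatives there and so does not fit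
  functions defined on the interval only.\<close>

definition C1_within :: "real set \<Rightarrow> (real \<Rightarrow> real) \<Rightarrow> bool" where
  "C1_within S f \<longleftrightarrow>
     (\<exists>f'. (\<forall>t\<in>S. (f has_real_derivative f' t) (at t within S)) \<and> continuous_on S f')"

end

theory Submission
  imports Defs
begin

text \<open>
  Differentiating the functional equation of \<open>\<Psi>\<close> yields a functional equation of the same
  kind for \<open>\<Psi>'\<close>, with scaling factors \<open>\<alpha>\<^sub>i / a\<^sub>i\<close> of modulus less than one.
  Iteration solves the latter by a continuous function, and an antiderivative of
  it solves the former up to additive constants; these vanish because
  \<open>\<Sum>\<^sub>i \<alpha>\<^sub>i < \<Sum>\<^sub>i a\<^sub>i = 1\<close>.  This gives existence and smoothness at once.  Uniqueness and positivity
  follow by evaluating the functional equation where \<open>\<bar>\<Psi>\<^sub>1 - \<Psi>\<^sub>2\<bar>\<close> is maximal, respectively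
  where \<open>\<Psi>\<close> is minimal: condition (ii) makes all four coefficients of the rational cubic
  nonnegative.
\<close>

section \<open>Gluing continuous pieces along consecutive intervals\<close>

lemma continuous_on_paste:
  fixes x :: "nat \<Rightarrow> real" and p :: "nat \<Rightarrow> real \<Rightarrow> 'a::topological_space"
  assumes "1 \<le> m"
    and "\<And>i. i \<in> {1..m} \<Longrightarrow> x i \<le> x (Suc i)"
    and "\<And>i. i \<in> {1..m} \<Longrightarrow> continuous_on {x i..x (Suc i)} (p i)"
    and "\<And>i. i \<in> {1..<m} \<Longrightarrow> p i (x (Suc i)) = p (Suc i) (x (Suc i))"
  shows "\<exists>g. continuous_on {x 1..x (Suc m)} g \<and>
             (\<forall>i\<in>{1..m}. \<forall>t\<in>{x i..x (Suc i)}. g t = p i t)"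
  using assms
proof (induction m rule: nat_induct_at_least)
  case base
  then show ?case by (intro exI[of _ "p 1"]) auto
next
  case (Suc m)
  obtain g where g: "continuous_on {x 1..x (Suc m)} g"
    and gp: "\<And>i t. i \<in> {1..m} \<Longrightarrow> t \<in> {x i..x (Suc i)} \<Longrightarrow> g t = p i t"
    using Suc.IH Suc.prems by force
  \<comment> \<open>All earlier pieces lie to the left of the joint \<open>x (Suc m)\<close>, so the
    case split defining \<open>f\<close> below leaves them to \<open>g\<close>.\<close>
  have below: "x i \<le> x (Suc m)" if "i \<in> {1..m}" for i
  proof -
    have "i \<le> Suc m" using that by simp
    then show ?thesis using that
    proof (induction i rule: inc_induct)
      case (step n)
      then show ?case
        using Suc.prems(1)[of n] by (cases "n = m") force+
    qed simp
  qed
  have gend: "g (x (Suc m)) = p (Suc m) (x (Suc m))"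
    using gp[of m "x (Suc m)"] Suc.prems(1)[of m] Suc.prems(3)[of m] Suc.hyps by auto
  define f where "f t = (if t \<le> x (Suc m) then g t else p (Suc m) t)" for t
  have "continuous_on {x 1..x (Suc (Suc m))} f"
    unfolding f_def
  proof (rule continuous_on_cases_le)
    show "continuous_on {t \<in> {x 1..x (Suc (Suc m))}. t \<le> x (Suc m)} g"
      by (rule continuous_on_subset[OF g]) auto
    show "continuous_on {t \<in> {x 1..x (Suc (Suc m))}. x (Suc m) \<le> t} (p (Suc m))"
      by (rule continuous_on_subset[OF Suc.prems(2)[of "Suc m"]]) auto
  qed (auto simp: gend)
  moreover have "f t = p i t" if i: "i \<in> {1..Suc m}" and t: "t \<in> {x i..x (Suc i)}" for i t
  proof (cases "i = Suc m")
    case True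
    then show ?thesis using t gend by (auto simp: f_def)
  next
    case False
    then have im: "i \<in> {1..m}" using i by auto
    have "x (Suc i) \<le> x (Suc m)"
      using below[of "Suc i"] im by (cases "i = m") auto
    then show ?thesis using gp[OF im t] t by (auto simp: f_def)
  qed
  ultimately show ?case by blast
qed

section \<open>Knots, the affine maps and their inverses\<close>

locale knots =
  fixes N :: nat and x :: "nat \<Rightarrow> real"
  assumes two_le: "2 \<le> N" and mono: "strict_mono_on {1..N} x"
begin

lemma knot_less: "i \<in> {1..N-1} \<Longrightarrow> x i < x (Suc i)"
  using strict_mono_onD[OF mono, of i "Suc i"] two_le by auto

lemma knot_le: "1 \<le> i \<Longrightarrow> i \<le> j \<Longrightarrow> j \<le> N \<Longrightarrow> x i \<le> x j"
  using mono by (cases "i = j") (auto simp: strict_mono_on_def intro: less_imp_le)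

lemma first_mem: "1 \<in> {1..N-1}"
  using two_le by auto

lemma last_mem: "N - 1 \<in> {1..N-1}"
  using two_le by auto

lemma ends_less: "x 1 < x N"
  using mono two_le by (auto simp: strict_mono_on_def)

lemma slope_pos: "i \<in> {1..N-1} \<Longrightarrow> 0 < aff_slope N x i"
  using knot_less ends_less by (simp add: aff_slope_def)

lemma aff_map_eq: "aff_map N x i t = x i + aff_slope N x i * (t - x 1)"
proof -
  \<comment> \<open>Replacing \<open>x N\<close> by \<open>x 1 + H\<close> leaves a single nonzero
    denominator.\<close>
  define H where "H = x N - x 1"
  have H: "H \<noteq> 0" and xN: "x N = x 1 + H" using ends_less by (auto simp: H_def)
  show ?thesis
    unfolding aff_map_def aff_slope_def aff_shift_def xN using H by (simp add: field_simps)
qed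

lemma aff_map_left: "aff_map N x i (x 1) = x i"
  by (simp add: aff_map_eq)

lemma aff_map_right: "aff_map N x i (x N) = x (Suc i)"
  using ends_less by (simp add: aff_map_eq aff_slope_def)

lemma aff_map_mem_piece:
  assumes "i \<in> {1..N-1}" "t \<in> {x 1..x N}"
  shows "aff_map N x i t \<in> {x i..x (Suc i)}"
proof -
  have "aff_slope N x i * (t - x 1) \<le> aff_slope N x i * (x N - x 1)"
    using assms slope_pos[OF assms(1)] by (intro mult_left_mono) auto
  moreover have "0 \<le> aff_slope N x i * (t - x 1)"
    using assms slope_pos[OF assms(1)] by auto
  ultimately show ?thesis
    using aff_map_right[of i] unfolding aff_map_eq atLeastAtMost_iff by linarith
qed

lemma piece_subset: "i \<in> {1..N-1} \<Longrightarrow> {x i..x (Suc i)} \<subseteq> {x 1..x N}"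
  using knot_le[of 1 i] knot_le[of "Suc i" N] by auto

lemma aff_map_mem:
  "i \<in> {1..N-1} \<Longrightarrow> t \<in> {x 1..x N} \<Longrightarrow> aff_map N x i t \<in> {x 1..x N}"
  using aff_map_mem_piece piece_subset by blast

definition inv_map :: "nat \<Rightarrow> real \<Rightarrow> real" where
  "inv_map i t = x 1 + (t - x i) / aff_slope N x i"

lemma aff_map_inv_map: "i \<in> {1..N-1} \<Longrightarrow> aff_map N x i (inv_map i t) = t"
  using slope_pos[of i] by (simp add: aff_map_eq inv_map_def)

lemma inv_map_aff_map: "i \<in> {1..N-1} \<Longrightarrow> inv_map i (aff_map N x i t) = t"
  using slope_pos[of i] by (simp add: aff_map_eq inv_map_def)

lemma inv_map_left: "inv_map i (x i) = x 1"
  by (simp add: inv_map_def)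

lemma inv_map_right: "i \<in> {1..N-1} \<Longrightarrow> inv_map i (x (Suc i)) = x N"
  by (metis aff_map_right inv_map_aff_map)

lemma inv_map_mem:
  assumes i: "i \<in> {1..N-1}" and t: "t \<in> {x i..x (Suc i)}"
  shows "inv_map i t \<in> {x 1..x N}"
proof -
  have "(t - x i) / aff_slope N x i \<le> (x (Suc i) - x i) / aff_slope N x i"
    using t slope_pos[OF i] by (intro divide_right_mono) auto
  then show ?thesis
    using t slope_pos[OF i] inv_map_right[OF i] by (auto simp: inv_map_def)
qed

lemma piece_cover:
  assumes "t \<in> {x 1..x N}"
  obtains i where "i \<in> {1..N-1}" "t \<in> {x i..x (Suc i)}"
proof (cases "t = x N")
  case True
  then show ?thesis
    using that[of "N - 1"] knot_le[of "N - 1" N] two_le by auto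
next
  case False
  \<comment> \<open>The first knot strictly to the right of \<open>t\<close> closes the piece
    sought. The right end \<open>t = x N\<close> is treated apart because \<open>N\<close> cannot
    witness such a knot there.\<close>
  define k where "k = (LEAST k. 1 \<le> k \<and> t < x k)"
  have ex: "1 \<le> N \<and> t < x N" using assms False two_le by auto
  have k: "1 \<le> k" "t < x k" unfolding k_def using LeastI[of "\<lambda>k. 1 \<le> k \<and> t < x k", OF ex] by auto
  have "k \<le> N" unfolding k_def by (rule Least_le) (rule ex)
  have "k \<noteq> 1" using k(2) assms by auto
  have "\<not> (1 \<le> k - 1 \<and> t < x (k - 1))"
    using not_less_Least[of "k - 1" "\<lambda>k. 1 \<le> k \<and> t < x k"] k(1) by (auto simp: k_def)
  moreover have "k - 1 \<in> {1..N-1}" "Suc (k - 1) = k"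
    using k \<open>k \<le> N\<close> \<open>k \<noteq> 1\<close> by auto
  ultimately show ?thesis
    using that[of "k - 1"] k by auto
qed

text \<open>The images of the interval under the affine maps cover it, so every value of a solution,
  in particular an extreme one, is described by the functional equation.\<close>

lemma aff_map_cover:
  assumes "t \<in> {x 1..x N}"
  obtains i s where "i \<in> {1..N-1}" "s \<in> {x 1..x N}" "t = aff_map N x i s"
proof -
  obtain i where "i \<in> {1..N-1}" "t \<in> {x i..x (Suc i)}"
    using piece_cover[OF assms] by blast
  then show ?thesis
    using that[of i "inv_map i t"] inv_map_mem aff_map_inv_map by simp
qed

text \<open>The lengths of the pieces telescope. This bounds every slope by one and later rules out
  additive constants.\<close>

lemma sum_slope: "(\<Sum>i\<in>{1..N-1}. aff_slope N x i) = 1"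
proof -
  have "(\<Sum>i\<in>{1..N-1}. aff_slope N x i) = (\<Sum>i=1..<N. x (Suc i) - x i) / (x N - x 1)"
    unfolding aff_slope_def sum_divide_distrib
    using two_le by (intro sum.cong) auto
  also have "(\<Sum>i=1..<N. x (Suc i) - x i) = x N - x 1"
    using two_le by (intro sum_Suc_diff') auto
  finally show ?thesis using ends_less by simp
qed

section \<open>Affine functional equations: existence, uniqueness, positivity\<close>

text \<open>A solution is a fixed point of the Read-Bajraktarevic operator, which sends
  \<open>f\<close> to the function equal to \<open>s i * f + q i\<close>, composed with
  \<open>inv_map i\<close>, on the i-th piece. It contracts sup distances by the largest
  \<open>\<bar>s i\<bar>\<close>. The conditions \<open>left\<close> and \<open>right\<close> make
  the pieces meet at the knots and preserve the end values.\<close>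

lemma functional_equation_exists:
  fixes s p :: "nat \<Rightarrow> real" and q :: "nat \<Rightarrow> real \<Rightarrow> real"
  assumes s: "\<And>i. i \<in> {1..N-1} \<Longrightarrow> \<bar>s i\<bar> < 1"
    and q: "\<And>i. i \<in> {1..N-1} \<Longrightarrow> continuous_on {x 1..x N} (q i)"
    and left: "\<And>i. i \<in> {1..N-1} \<Longrightarrow> s i * p 1 + q i (x 1) = p i"
    and right: "\<And>i. i \<in> {1..N-1} \<Longrightarrow> s i * p N + q i (x N) = p (Suc i)"
  shows "\<exists>f. continuous_on {x 1..x N} f \<and> f (x 1) = p 1 \<and> f (x N) = p N \<and>
             (\<forall>i\<in>{1..N-1}. \<forall>t\<in>{x 1..x N}. f (aff_map N x i t) = s i * f t + q i t)"
proof -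
  define I where "I = {x 1..x N}"
  \<comment> \<open>The end values belong to the invariant class because adjacent pieces of the
    image match only for these values.\<close>
  define adm where "adm f \<longleftrightarrow> continuous_on I f \<and> f (x 1) = p 1 \<and> f (x N) = p N" for f
  \<comment> \<open>The operator appears as a relation, since pasting provides its value only
    existentially; dependent choice then yields the iterates.\<close>
  define rel where "rel f g \<longleftrightarrow> (\<forall>i\<in>{1..N-1}. \<forall>t\<in>I. g (aff_map N x i t) = s i * f t + q i t)" for f g
  have step: "\<exists>g. adm g \<and> rel f g" if f: "adm f" for f
  proof -
    define r where "r i t = s i * f (inv_map i t) + q i (inv_map i t)" for i t
    have rl: "r i (x i) = p i" and rr: "r i (x (Suc i)) = p (Suc i)" if "i \<in> {1..N-1}" for i
      using left[OF that] right[OF that] f that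
      by (simp_all add: r_def inv_map_left inv_map_right adm_def)
    have cont: "continuous_on {x i..x (Suc i)} (r i)" if i: "i \<in> {1..N-1}" for i
    proof -
      have im: "continuous_on {x i..x (Suc i)} (inv_map i)"
        using slope_pos[OF i] unfolding inv_map_def by (intro continuous_intros) auto
      have sub: "inv_map i ` {x i..x (Suc i)} \<subseteq> {x 1..x N}"
        using inv_map_mem[OF i] by blast
      show ?thesis unfolding r_def
        using f q[OF i] unfolding adm_def I_def
        by (intro continuous_intros continuous_on_compose2[OF _ im sub]) auto
    qed
    obtain g where g: "continuous_on {x 1..x (Suc (N-1))} g"
      and gr: "\<And>i t. i \<in> {1..N-1} \<Longrightarrow> t \<in> {x i..x (Suc i)} \<Longrightarrow> g t = r i t"
      using continuous_on_paste[of "N-1" x r] two_le knot_less cont rl rr by (force intro: less_imp_le)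
    have N: "Suc (N - 1) = N" using two_le by simp
    have "g (x 1) = p 1"
      using gr[OF first_mem, of "x 1"] rl[OF first_mem] knot_less[OF first_mem] by simp
    moreover have "g (x N) = p N"
      using gr[OF last_mem, of "x N"] rr[OF last_mem] knot_less[OF last_mem] N by simp
    moreover have "rel f g"
      unfolding rel_def
      using gr aff_map_mem_piece inv_map_aff_map by (auto simp: I_def r_def)
    ultimately show ?thesis using g N by (auto simp: adm_def I_def)
  qed
  have "\<exists>f. adm f"
  proof
    \<comment> \<open>The chord through the two end points starts the iteration.\<close>
    show "adm (\<lambda>t. p 1 + (t - x 1) / (x N - x 1) * (p N - p 1))"
      using ends_less unfolding adm_def by (auto intro!: continuous_intros)
  qed
  then obtain F where F: "\<And>n. adm (F n)" and FS: "\<And>n. rel (F n) (F (Suc n))"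
    using dependent_nat_choice[of "\<lambda>_. adm" "\<lambda>_. rel"] step by metis
  define c where "c = Max ((\<lambda>i. \<bar>s i\<bar>) ` {1..N-1})"
  have ne: "{1..N-1} \<noteq> {}" using two_le by auto
  have c1: "c < 1" unfolding c_def using s ne by (subst Max_less_iff) auto
  have sc: "\<bar>s i\<bar> \<le> c" if "i \<in> {1..N-1}" for i unfolding c_def using that by auto
  have c0: "0 \<le> c" using sc[of 1] two_le by force
  have "bounded ((\<lambda>t. F 1 t - F 0 t) ` I)"
    using F unfolding adm_def I_def
    by (intro compact_imp_bounded compact_continuous_image continuous_intros) auto
  then obtain M where M: "\<And>t. t \<in> I \<Longrightarrow> \<bar>F 1 t - F 0 t\<bar> \<le> M"
    by (auto simp: bounded_iff)
  \<comment> \<open>In the difference of consecutive iterates the terms \<open>q i\<close> cancel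
    and a factor \<open>s i\<close> remains.\<close>
  have bound: "\<forall>t\<in>I. \<bar>F (Suc n) t - F n t\<bar> \<le> M * c ^ n" for n
  proof (induction n)
    case 0
    then show ?case using M by simp
  next
    case (Suc n)
    show ?case
    proof
      fix t assume "t \<in> I"
      then obtain i r where i: "i \<in> {1..N-1}" and r: "r \<in> I" and t: "t = aff_map N x i r"
        using aff_map_cover unfolding I_def by blast
      have "F (Suc (Suc n)) t - F (Suc n) t = s i * (F (Suc n) r - F n r)"
        using FS i r by (simp add: rel_def t algebra_simps)
      also have "\<bar>\<dots>\<bar> \<le> c * (M * c ^ n)"
        unfolding abs_mult using sc[OF i] Suc.IH r c0 by (intro mult_mono) auto
      finally show "\<bar>F (Suc (Suc n)) t - F (Suc n) t\<bar> \<le> M * c ^ Suc n"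
        by (simp add: mult_ac)
    qed
  qed
  have summ: "summable (\<lambda>n. M * c ^ n)"
    using c0 c1 by (intro summable_mult summable_geometric) auto
  have lim0: "uniform_limit I (\<lambda>n t. \<Sum>k<n. F (Suc k) t - F k t)
      (\<lambda>t. \<Sum>k. F (Suc k) t - F k t) sequentially"
    by (rule Weierstrass_m_test[OF _ summ]) (use bound in auto)
  \<comment> \<open>The telescoping series converges uniformly by the M-test, so \<open>f\<close> is
    the uniform limit of the iterates.\<close>
  define f where "f t = F 0 t + (\<Sum>k. F (Suc k) t - F k t)" for t
  have "uniform_limit I (\<lambda>n t. F 0 t + (\<Sum>k<n. F (Suc k) t - F k t)) f sequentially"
    unfolding f_def by (intro uniform_limit_add uniform_limit_const lim0)
  moreover have "F 0 t + (\<Sum>k<n. F (Suc k) t - F k t) = F n t" for n t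
    using sum_lessThan_telescope[of "\<lambda>k. F k t" n] by simp
  ultimately have lim: "uniform_limit I F f sequentially"
    by simp
  have pt: "(\<lambda>n. F n t) \<longlonglongrightarrow> f t" if "t \<in> I" for t
    using tendsto_uniform_limitI[OF lim that] .
  have ends: "x 1 \<in> I" "x N \<in> I" using ends_less by (auto simp: I_def)
  have "continuous_on I f"
    by (rule uniform_limit_theorem[OF _ lim]) (use F in \<open>auto simp: adm_def\<close>)
  moreover have "f (x 1) = p 1" "f (x N) = p N"
    using pt[OF ends(1)] pt[OF ends(2)] F by (simp_all add: adm_def LIMSEQ_const_iff)
  moreover have "f (aff_map N x i t) = s i * f t + q i t" if i: "i \<in> {1..N-1}" and t: "t \<in> I" for i t
  proof (rule LIMSEQ_unique)
    show "(\<lambda>n. F (Suc n) (aff_map N x i t)) \<longlonglongrightarrow> f (aff_map N x i t)"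
      using aff_map_mem i t pt unfolding I_def by (intro LIMSEQ_Suc) auto
    have "(\<lambda>n. s i * F n t + q i t) \<longlonglongrightarrow> s i * f t + q i t"
      by (intro tendsto_intros pt t)
    then show "(\<lambda>n. F (Suc n) (aff_map N x i t)) \<longlonglongrightarrow> s i * f t + q i t"
      using FS i t by (simp add: rel_def)
  qed
  ultimately show ?thesis unfolding I_def by blast
qed

text \<open>If \<open>\<bar>f - g\<bar>\<close> is maximal at the image of \<open>r\<close> under
  the i-th map, the maximum equals \<open>\<bar>s i\<bar>\<close> times the value at
  \<open>r\<close>, hence at most \<open>\<bar>s i\<bar>\<close> times itself. It is therefore
  zero.\<close>

lemma functional_equation_unique:
  fixes s :: "nat \<Rightarrow> real" and q :: "nat \<Rightarrow> real \<Rightarrow> real"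
  assumes s: "\<And>i. i \<in> {1..N-1} \<Longrightarrow> \<bar>s i\<bar> < 1"
    and f: "continuous_on {x 1..x N} f"
      "\<And>i t. i \<in> {1..N-1} \<Longrightarrow> t \<in> {x 1..x N} \<Longrightarrow> f (aff_map N x i t) = s i * f t + q i t"
    and g: "continuous_on {x 1..x N} g"
      "\<And>i t. i \<in> {1..N-1} \<Longrightarrow> t \<in> {x 1..x N} \<Longrightarrow> g (aff_map N x i t) = s i * g t + q i t"
    and t: "t \<in> {x 1..x N}"
  shows "f t = g t"
proof -
  have "continuous_on {x 1..x N} (\<lambda>t. \<bar>f t - g t\<bar>)"
    by (intro continuous_intros f g)
  then obtain m where m: "m \<in> {x 1..x N}"
    and max: "\<And>t. t \<in> {x 1..x N} \<Longrightarrow> \<bar>f t - g t\<bar> \<le> \<bar>f m - g m\<bar>"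
    using continuous_attains_sup[of "{x 1..x N}" "\<lambda>t. \<bar>f t - g t\<bar>"] ends_less by fastforce
  obtain i r where i: "i \<in> {1..N-1}" and r: "r \<in> {x 1..x N}" and mr: "m = aff_map N x i r"
    using aff_map_cover[OF m] by blast
  have "f m - g m = s i * (f r - g r)"
    using f(2)[OF i r] g(2)[OF i r] by (simp add: mr algebra_simps)
  then have "\<bar>f m - g m\<bar> \<le> \<bar>s i\<bar> * \<bar>f m - g m\<bar>"
    using max[OF r] by (simp add: abs_mult mult_left_mono)
  then have "(1 - \<bar>s i\<bar>) * \<bar>f m - g m\<bar> \<le> 0" by (simp add: algebra_simps)
  then have "\<bar>f m - g m\<bar> \<le> 0" using s[OF i] by (simp add: mult_le_0_iff)
  then show ?thesis using max[OF t] by simp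
qed

text \<open>At a minimum \<open>m\<close>, the image of \<open>r\<close> under the i-th map,
  nonnegativity of \<open>s i\<close> gives \<open>f m = s i * f r + q i r > s i * f m\<close>.
  Since \<open>s i < 1\<close>, the minimum is positive.\<close>

lemma functional_equation_pos:
  fixes s :: "nat \<Rightarrow> real" and q :: "nat \<Rightarrow> real \<Rightarrow> real"
  assumes s: "\<And>i. i \<in> {1..N-1} \<Longrightarrow> 0 \<le> s i \<and> s i < 1"
    and q: "\<And>i t. i \<in> {1..N-1} \<Longrightarrow> t \<in> {x 1..x N} \<Longrightarrow> 0 < q i t"
    and f: "continuous_on {x 1..x N} f"
      "\<And>i t. i \<in> {1..N-1} \<Longrightarrow> t \<in> {x 1..x N} \<Longrightarrow> f (aff_map N x i t) = s i * f t + q i t"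
    and t: "t \<in> {x 1..x N}"
  shows "0 < f t"
proof -
  obtain m where m: "m \<in> {x 1..x N}"
    and min: "\<And>t. t \<in> {x 1..x N} \<Longrightarrow> f m \<le> f t"
    using continuous_attains_inf[of "{x 1..x N}" f] f(1) ends_less by fastforce
  obtain i r where i: "i \<in> {1..N-1}" and r: "r \<in> {x 1..x N}" and mr: "m = aff_map N x i r"
    using aff_map_cover[OF m] by blast
  have "s i * f m \<le> s i * f r"
    using min[OF r] s[OF i] by (simp add: mult_left_mono)
  then have "0 < (1 - s i) * f m"
    using f(2)[OF i r] q[OF i r] by (simp add: mr algebra_simps)
  then have "0 < f m" using s[OF i] by (simp add: zero_less_mult_iff)
  then show ?thesis using min[OF t] by simp
qed

section \<open>Continuously differentiable solutions\<close>

text \<open>\<open>Rl\<close> and \<open>Rr\<close> are the matching conditions at the knots for the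
  values \<open>y\<close>. \<open>R'l\<close> and \<open>R'r\<close> are those for the derivatives
  \<open>d\<close> in the differentiated equation.\<close>

lemma C1_functional_equation_exists:
  fixes \<alpha> y d :: "nat \<Rightarrow> real" and R R' :: "nat \<Rightarrow> real \<Rightarrow> real"
  assumes \<alpha>: "\<And>i. i \<in> {1..N-1} \<Longrightarrow> \<bar>\<alpha> i\<bar> < aff_slope N x i"
    and R: "\<And>i t. i \<in> {1..N-1} \<Longrightarrow> t \<in> {x 1..x N} \<Longrightarrow>
              (R i has_real_derivative R' i t) (at t within {x 1..x N})"
    and R': "\<And>i. i \<in> {1..N-1} \<Longrightarrow> continuous_on {x 1..x N} (R' i)"
    and Rl: "\<And>i. i \<in> {1..N-1} \<Longrightarrow> R i (x 1) = y i - \<alpha> i * y 1"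
    and Rr: "\<And>i. i \<in> {1..N-1} \<Longrightarrow> R i (x N) = y (Suc i) - \<alpha> i * y N"
    and R'l: "\<And>i. i \<in> {1..N-1} \<Longrightarrow> R' i (x 1) = aff_slope N x i * d i - \<alpha> i * d 1"
    and R'r: "\<And>i. i \<in> {1..N-1} \<Longrightarrow> R' i (x N) = aff_slope N x i * d (Suc i) - \<alpha> i * d N"
  shows "\<exists>f. C1_within {x 1..x N} f \<and> f (x 1) = y 1 \<and> f (x N) = y N \<and>
             (\<forall>i\<in>{1..N-1}. \<forall>t\<in>{x 1..x N}. f (aff_map N x i t) = \<alpha> i * f t + R i t)"
proof -
  let ?I = "{x 1..x N}" and ?a = "aff_slope N x"
  have a: "0 < ?a i" if "i \<in> {1..N-1}" for i using slope_pos[OF that] .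
  \<comment> \<open>This is the differentiated equation after division by the factor
    \<open>?a i\<close> from the chain rule; \<open>g\<close> is the future derivative.\<close>
  have "\<exists>g. continuous_on ?I g \<and> g (x 1) = d 1 \<and> g (x N) = d N \<and>
      (\<forall>i\<in>{1..N-1}. \<forall>t\<in>?I. g (aff_map N x i t) = \<alpha> i / ?a i * g t + R' i t / ?a i)"
  proof (rule functional_equation_exists)
    fix i assume i: "i \<in> {1..N-1}"
    show "\<bar>\<alpha> i / ?a i\<bar> < 1" using \<alpha>[OF i] a[OF i] by simp
    show "continuous_on ?I (\<lambda>t. R' i t / ?a i)"
      using a[OF i] by (intro continuous_intros R' i) auto
    show "\<alpha> i / ?a i * d 1 + R' i (x 1) / ?a i = d i"
      "\<alpha> i / ?a i * d N + R' i (x N) / ?a i = d (Suc i)"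
      using a[OF i] R'l[OF i] R'r[OF i] by (simp_all add: field_simps)
  qed
  then obtain g where g: "continuous_on ?I g"
    and geq: "\<And>i t. i \<in> {1..N-1} \<Longrightarrow> t \<in> ?I \<Longrightarrow>
        g (aff_map N x i t) = \<alpha> i / ?a i * g t + R' i t / ?a i"
    by blast
  \<comment> \<open>The constant \<open>y 1\<close> settles the left end value. The values at the
    other knots are only identified through \<open>e\<close> below.\<close>
  define f where "f t = y 1 + integral {x 1..t} g" for t
  have fg: "(f has_real_derivative g t) (at t within ?I)" if "t \<in> ?I" for t
    unfolding f_def using integral_has_real_derivative[OF g that]
    by (auto intro!: derivative_eq_intros)
  \<comment> \<open>The defect in the functional equation has zero derivative by the choice of
    \<open>g\<close>, so it equals its value at \<open>x 1\<close>.\<close>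
  have const: "f (aff_map N x i t) - \<alpha> i * f t - R i t = f (x i) - y i - \<alpha> i * (f (x 1) - y 1)"
    if i: "i \<in> {1..N-1}" and t: "t \<in> ?I" for i t
  proof -
    define D where "D t = f (aff_map N x i t) - \<alpha> i * f t - R i t" for t
    have D0: "(D has_real_derivative 0) (at t within ?I)" if t: "t \<in> ?I" for t
    proof -
      have sub: "aff_map N x i ` ?I \<subseteq> ?I" using aff_map_mem[OF i] by blast
      have 1: "(f has_real_derivative g (aff_map N x i t)) (at (aff_map N x i t) within aff_map N x i ` ?I)"
        using has_field_derivative_subset[OF fg[OF aff_map_mem[OF i t]] sub] .
      have 2: "(aff_map N x i has_real_derivative ?a i) (at t within ?I)"
        unfolding aff_map_def by (auto intro!: derivative_eq_intros)
      have "((\<lambda>t. f (aff_map N x i t)) has_real_derivative g (aff_map N x i t) * ?a i) (at t within ?I)"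
        using DERIV_image_chain[OF 1 2] by (simp add: o_def)
      then have "(D has_real_derivative g (aff_map N x i t) * ?a i - \<alpha> i * g t - R' i t) (at t within ?I)"
        unfolding D_def by (intro derivative_intros DERIV_cmult fg t R i)
      then show ?thesis using geq[OF i t] a[OF i] by (simp add: field_simps)
    qed
    have "D t = D (x 1)"
      using has_field_derivative_zero_constant[of ?I D] D0 t ends_less by fastforce
    then show ?thesis
      using aff_map_left[of i] Rl[OF i] by (simp add: D_def algebra_simps)
  qed
  \<comment> \<open>The error at the knots; if it vanishes, so does every defect. Evaluating the
    constant defect at \<open>x N\<close> gives a recursion whose summation makes \<open>e N\<close>
    equal to the sum of the \<open>\<alpha> i\<close> times itself, and that sum is below
    one.\<close>
  define e where "e i = f (x i) - y i" for i
  have e1: "e 1 = 0" by (simp add: e_def f_def)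
  have eS: "e (Suc i) = e i + \<alpha> i * e N" if "i \<in> {1..N-1}" for i
    using const[OF that, of "x N"] ends_less e1
      aff_map_right[of i] Rr[OF that]
    by (simp add: e_def algebra_simps)
  have esum: "e (Suc m) = (\<Sum>i\<in>{1..m}. \<alpha> i) * e N" if "m \<le> N - 1" for m
    using that
  proof (induction m)
    case 0
    then show ?case using e1 by simp
  next
    case (Suc m)
    then show ?case using eS[of "Suc m"] by (simp add: algebra_simps)
  qed
  have "(\<Sum>i\<in>{1..N-1}. \<alpha> i) < (\<Sum>i\<in>{1..N-1}. ?a i)"
    using two_le \<alpha> by (intro sum_strict_mono) (force+)
  then have "(\<Sum>i\<in>{1..N-1}. \<alpha> i) < 1" by (simp only: sum_slope)
  moreover have "e N = (\<Sum>i\<in>{1..N-1}. \<alpha> i) * e N"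
    using esum[of "N-1"] two_le by simp
  ultimately have eN: "e N = 0" by (metis less_irrefl mult_cancel_right1)
  have e0: "e i = 0" if "i \<in> {1..N-1}" for i
    using esum[of "i - 1"] that eN by auto
  have "C1_within ?I f" unfolding C1_within_def using fg g by blast
  moreover have "f (x 1) = y 1" "f (x N) = y N" using e1 eN by (auto simp: e_def)
  moreover have "f (aff_map N x i t) = \<alpha> i * f t + R i t" if "i \<in> {1..N-1}" "t \<in> ?I" for i t
    using const[OF that] e0[OF that(1)] e1 by (simp add: e_def)
  ultimately show ?thesis by blast
qed

end

section \<open>Derivatives within a set, and the rational cubic\<close>

lemma C1_within_imp_continuous_on: "C1_within S f \<Longrightarrow> continuous_on S f"
  unfolding C1_within_def by (meson DERIV_continuous_on)

text \<open>A derivative within \<open>S\<close> at a point of \<open>S\<close> sees only values on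
  \<open>S\<close>. This carries smoothness from a constructed solution to \<open>rcsfif\<close>,
  which is compared with it on the interval only.\<close>

lemma C1_within_cong:
  assumes "\<And>t. t \<in> S \<Longrightarrow> f t = g t"
  shows "C1_within S f \<longleftrightarrow> C1_within S g"
proof -
  have "(f has_real_derivative c) (at t within S) \<longleftrightarrow> (g has_real_derivative c) (at t within S)"
    if "t \<in> S" for c t
    unfolding has_field_derivative_def
    using that assms has_derivative_transform[of t S f g] has_derivative_transform[of t S g f] by auto
  then show ?thesis unfolding C1_within_def by simp
qed

lemma rc_den_pos:
  "0 < u i \<Longrightarrow> 0 \<le> v i \<Longrightarrow> \<theta> \<in> {0..1} \<Longrightarrow> 0 < rc_den u v i \<theta>"
  unfolding rc_den_def by (intro add_pos_nonneg) auto

text \<open>The quotient rule for arbitrary coefficients, so that the lengthy ones of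
  \<open>rc_num\<close> need only be substituted into the two end values.\<close>

lemma cubic_quotient_deriv:
  fixes U V W Z u v :: real
  assumes u: "0 < u" and v: "0 \<le> v"
  shows "\<exists>r'. (\<forall>\<theta>\<in>{0..1}. ((\<lambda>\<theta>. (U * (1 - \<theta>) ^ 3 + V * (1 - \<theta>)\<^sup>2 * \<theta> + W * (1 - \<theta>) * \<theta>\<^sup>2 + Z * \<theta> ^ 3)
                  / (u + v * \<theta> * (1 - \<theta>))) has_real_derivative r' \<theta>) (at \<theta>)) \<and>
              continuous_on {0..1} r' \<and>
              r' 0 = (u * (V - 3 * U) - U * v) / u\<^sup>2 \<and> r' 1 = (u * (3 * Z - W) + Z * v) / u\<^sup>2"
proof -
  have den: "u + v * \<theta> * (1 - \<theta>) \<noteq> 0" if "\<theta> \<in> {0..1}" for \<theta>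
    using that rc_den_pos[of "\<lambda>_. u" 0 "\<lambda>_. v" \<theta>] u v by (simp add: rc_den_def)
  define p where "p \<theta> = U * (1 - \<theta>) ^ 3 + V * (1 - \<theta>)\<^sup>2 * \<theta> + W * (1 - \<theta>) * \<theta>\<^sup>2 + Z * \<theta> ^ 3" for \<theta>
  define p' where "p' \<theta> = - 3 * U * (1 - \<theta>)\<^sup>2 + V * ((1 - \<theta>)\<^sup>2 - 2 * (1 - \<theta>) * \<theta>)
      + W * (2 * (1 - \<theta>) * \<theta> - \<theta>\<^sup>2) + 3 * Z * \<theta>\<^sup>2" for \<theta>
  define r' where "r' \<theta> = (p' \<theta> * (u + v * \<theta> * (1 - \<theta>)) - p \<theta> * (v * (1 - 2 * \<theta>)))
      / (u + v * \<theta> * (1 - \<theta>))\<^sup>2" for \<theta>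
  have p: "(p has_real_derivative p' \<theta>) (at \<theta>)" for \<theta>
    unfolding p_def p'_def
    by (rule derivative_eq_intros refl)+ (simp add: algebra_simps power2_eq_square)
  have q: "((\<lambda>\<theta>. u + v * \<theta> * (1 - \<theta>)) has_real_derivative v * (1 - 2 * \<theta>)) (at \<theta>)" for \<theta>
    by (rule derivative_eq_intros refl)+ (simp add: algebra_simps)
  have "((\<lambda>\<theta>. p \<theta> / (u + v * \<theta> * (1 - \<theta>))) has_real_derivative r' \<theta>) (at \<theta>)" if "\<theta> \<in> {0..1}" for \<theta>
    using DERIV_divide[OF p q den[OF that]] by (simp add: r'_def power2_eq_square)
  moreover have "continuous_on {0..1} r'"
    unfolding r'_def p'_def p_def using den by (intro continuous_intros) auto
  moreover have "r' 0 = (u * (V - 3 * U) - U * v) / u\<^sup>2" "r' 1 = (u * (3 * Z - W) + Z * v) / u\<^sup>2"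
    by (simp_all add: r'_def p'_def p_def algebra_simps)
  ultimately show ?thesis unfolding p_def by blast
qed

text \<open>This is what the coefficients \<open>V\<close> and \<open>W\<close> are designed for:
  their parts with \<open>3 * u i + v i\<close> cancel the contributions of \<open>U\<close>,
  \<open>Z\<close> and the denominator to the end derivatives, leaving just the Hermite
  data.\<close>

lemma rc_quotient_deriv:
  assumes u: "0 < u i" and v: "0 \<le> v i"
  shows "\<exists>r'. (\<forall>\<theta>\<in>{0..1}. ((\<lambda>\<theta>. rc_num N x y d \<alpha> u v i \<theta> / rc_den u v i \<theta>)
                  has_real_derivative r' \<theta>) (at \<theta>)) \<and>
              continuous_on {0..1} r' \<and>
              r' 0 = (x (Suc i) - x i) * d i - \<alpha> i * (x N - x 1) * d 1 \<and>
              r' 1 = (x (Suc i) - x i) * d (Suc i) - \<alpha> i * (x N - x 1) * d N"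
proof -
  let ?h = "x (Suc i) - x i" and ?H = "x N - x 1"
  let ?A = "y i - \<alpha> i * y 1" and ?B = "y (Suc i) - \<alpha> i * y N"
  let ?U = "u i * ?A" and ?Z = "u i * ?B"
  let ?V = "(3 * u i + v i) * ?A + u i * ?h * d i - \<alpha> i * u i * ?H * d 1"
  let ?W = "(3 * u i + v i) * ?B - u i * ?h * d (Suc i) + \<alpha> i * u i * ?H * d N"
  have "u i * (?V - 3 * ?U) - ?U * v i = (u i)\<^sup>2 * (?h * d i - \<alpha> i * ?H * d 1)"
    "u i * (3 * ?Z - ?W) + ?Z * v i = (u i)\<^sup>2 * (?h * d (Suc i) - \<alpha> i * ?H * d N)"
    by algebra+
  then show ?thesis
    using cubic_quotient_deriv[OF u v, of ?U ?V ?W ?Z] u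
    unfolding rc_num_def rc_den_def Let_def by simp
qed

text \<open>\<open>v1\<close> and \<open>v2\<close> say that \<open>V\<close> and \<open>W\<close>
  are nonnegative, divided by the positive quantities from \<open>A\<close> and \<open>B\<close>;
  the latter make \<open>U\<close> and \<open>Z\<close> positive.\<close>

lemma rc_num_pos:
  assumes u: "0 < u i" and A: "\<alpha> i * y 1 < y i" and B: "\<alpha> i * y N < y (Suc i)"
    and v1: "v i \<ge> - u i * (3 + ((x (Suc i) - x i) * d i - \<alpha> i * (x N - x 1) * d 1)
                            / (y i - \<alpha> i * y 1))"
    and v2: "v i \<ge> - u i * (3 + (- (x (Suc i) - x i) * d (Suc i) + \<alpha> i * (x N - x 1) * d N)
                            / (y (Suc i) - \<alpha> i * y N))"
    and \<theta>: "\<theta> \<in> {0..1}"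
  shows "0 < rc_num N x y d \<alpha> u v i \<theta>"
proof -
  have coeff: "0 \<le> (3 * u i + v i) * c + u i * e"
    if "0 < c" "v i \<ge> - u i * (3 + e / c)" for c e
  proof -
    have "- u i * (3 + e / c) * c \<le> v i * c" using that by (intro mult_right_mono) auto
    then show ?thesis using \<open>0 < c\<close> by (simp add: algebra_simps)
  qed
  have V: "0 \<le> (3 * u i + v i) * (y i - \<alpha> i * y 1) + u i * (x (Suc i) - x i) * d i
               - \<alpha> i * u i * (x N - x 1) * d 1"
    using coeff[OF _ v1] A by (simp add: algebra_simps)
  have W: "0 \<le> (3 * u i + v i) * (y (Suc i) - \<alpha> i * y N) - u i * (x (Suc i) - x i) * d (Suc i)
               + \<alpha> i * u i * (x N - x 1) * d N"
    using coeff[OF _ v2] B by (simp add: algebra_simps)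
  \<comment> \<open>Strictness comes from the outer terms: \<open>1 - \<theta>\<close> and
    \<open>\<theta>\<close> never vanish together.\<close>
  have UZ: "0 < u i * (y i - \<alpha> i * y 1) * (1 - \<theta>) ^ 3 + u i * (y (Suc i) - \<alpha> i * y N) * \<theta> ^ 3"
    (is "0 < ?U * _ + ?Z * _")
  proof (cases "\<theta> = 0")
    case False
    then show ?thesis using u A B \<theta> by (intro add_nonneg_pos mult_nonneg_nonneg mult_pos_pos) auto
  qed (use u A in simp)
  show ?thesis
    unfolding rc_num_def Let_def
    using UZ mult_nonneg_nonneg[OF mult_nonneg_nonneg[OF V, of "(1 - \<theta>)\<^sup>2"], of \<theta>]
      mult_nonneg_nonneg[OF mult_nonneg_nonneg[OF W, of "1 - \<theta>"], of "\<theta>\<^sup>2"] \<theta>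
    by auto
qed

section \<open>The rational cubic spline fractal interpolation function\<close>

context knots
begin

lemma param_mem: "t \<in> {x 1..x N} \<Longrightarrow> (t - x 1) / (x N - x 1) \<in> {0..1}"
  using ends_less by auto

lemma is_rcsfif_cong:
  assumes "\<And>t. t \<in> {x 1..x N} \<Longrightarrow> f t = g t"
  shows "is_rcsfif N x y d \<alpha> u v f \<longleftrightarrow> is_rcsfif N x y d \<alpha> u v g"
proof -
  have "continuous_on {x 1..x N} f \<longleftrightarrow> continuous_on {x 1..x N} g"
    using assms by (intro continuous_on_cong) auto
  moreover have "f (x 1) = g (x 1)" "f (x N) = g (x N)"
    using assms ends_less by auto
  ultimately show ?thesis
    unfolding is_rcsfif_def using assms aff_map_mem by simp
qed

text \<open>One slope is at most the sum of all of them. A scaling factor bounded by its slope is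
  thus a contraction factor.\<close>

lemma slope_le_1:
  assumes "i \<in> {1..N-1}"
  shows "aff_slope N x i \<le> 1"
proof -
  have "aff_slope N x i \<le> (\<Sum>i\<in>{1..N-1}. aff_slope N x i)"
    using assms slope_pos by (intro member_le_sum) (auto intro: less_imp_le)
  then show ?thesis by (simp only: sum_slope)
qed

lemma is_rcsfif_unique:
  assumes f: "is_rcsfif N x y d \<alpha> u v f" and g: "is_rcsfif N x y d \<alpha> u v g"
    and t: "t \<in> {x 1..x N}"
  shows "f t = g t"
proof (rule functional_equation_unique[OF _ _ _ _ _ t])
  show "\<bar>\<alpha> i\<bar> < 1" if "i \<in> {1..N-1}" for i
    using f slope_le_1[OF that] that unfolding is_rcsfif_def by force
qed (use f g in \<open>auto simp: is_rcsfif_def\<close>)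

lemma C1_rcsfif_exists:
  assumes \<alpha>: "\<And>i. i \<in> {1..N-1} \<Longrightarrow> \<bar>\<alpha> i\<bar> < aff_slope N x i"
    and u: "\<And>i. i \<in> {1..N-1} \<Longrightarrow> 0 < u i" and v: "\<And>i. i \<in> {1..N-1} \<Longrightarrow> 0 \<le> v i"
  shows "\<exists>f. is_rcsfif N x y d \<alpha> u v f \<and> C1_within {x 1..x N} f"
proof -
  define H where "H = x N - x 1"
  have H: "0 < H" using ends_less by (simp add: H_def)
  let ?r = "\<lambda>i \<theta>. rc_num N x y d \<alpha> u v i \<theta> / rc_den u v i \<theta>"
  define R where "R i t = ?r i ((t - x 1) / H)" for i t
  obtain r' where
    r: "\<And>i \<theta>. i \<in> {1..N-1} \<Longrightarrow> \<theta> \<in> {0..1} \<Longrightarrow> (?r i has_real_derivative r' i \<theta>) (at \<theta>)" and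
    r': "\<And>i. i \<in> {1..N-1} \<Longrightarrow> continuous_on {0..1} (r' i)" and
    r'0: "\<And>i. i \<in> {1..N-1} \<Longrightarrow> r' i 0 = (x (Suc i) - x i) * d i - \<alpha> i * H * d 1" and
    r'1: "\<And>i. i \<in> {1..N-1} \<Longrightarrow> r' i 1 = (x (Suc i) - x i) * d (Suc i) - \<alpha> i * H * d N"
  proof -
    have "\<forall>i\<in>{1..N-1}. \<exists>r'. (\<forall>\<theta>\<in>{0..1}. (?r i has_real_derivative r' \<theta>) (at \<theta>)) \<and>
              continuous_on {0..1} r' \<and>
              r' 0 = (x (Suc i) - x i) * d i - \<alpha> i * H * d 1 \<and>
              r' 1 = (x (Suc i) - x i) * d (Suc i) - \<alpha> i * H * d N"
      unfolding H_def using rc_quotient_deriv u v by blast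
    from bchoice[OF this] show ?thesis using that by blast
  qed
  have "\<exists>f. C1_within {x 1..x N} f \<and> f (x 1) = y 1 \<and> f (x N) = y N \<and>
             (\<forall>i\<in>{1..N-1}. \<forall>t\<in>{x 1..x N}. f (aff_map N x i t) = \<alpha> i * f t + R i t)"
  proof (rule C1_functional_equation_exists[where d = d])
    fix i assume i: "i \<in> {1..N-1}"
    show "\<bar>\<alpha> i\<bar> < aff_slope N x i" using \<alpha>[OF i] .
    \<comment> \<open>The factor \<open>1 / H\<close> from rescaling the parameter turns the knot
      distance in \<open>r'0\<close> and \<open>r'1\<close> into \<open>aff_slope N x i\<close> and
      cancels the \<open>H\<close> beside \<open>\<alpha> i\<close>, as the derivative matching
      conditions demand.\<close>
    show "(R i has_real_derivative r' i ((t - x 1) / H) / H) (at t within {x 1..x N})"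
      if "t \<in> {x 1..x N}" for t
    proof -
      have \<theta>: "((\<lambda>t. (t - x 1) / H) has_real_derivative 1 / H) (at t within {x 1..x N})"
        using H by (auto intro!: derivative_eq_intros)
      show ?thesis
        unfolding R_def
        using DERIV_chain2[OF r[OF i param_mem[OF that, folded H_def]] \<theta>] by simp
    qed
    show "continuous_on {x 1..x N} (\<lambda>t. r' i ((t - x 1) / H) / H)"
      using H param_mem unfolding H_def
      by (intro continuous_intros continuous_on_compose2[OF r'[OF i]]) auto
    show "R i (x 1) = y i - \<alpha> i * y 1" "R i (x N) = y (Suc i) - \<alpha> i * y N"
      using u[OF i] H unfolding R_def H_def[symmetric]
      by (simp_all add: rc_num_def rc_den_def Let_def)
    show "r' i ((x 1 - x 1) / H) / H = aff_slope N x i * d i - \<alpha> i * d 1"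
      using H r'0[OF i] unfolding aff_slope_def H_def[symmetric] by (simp add: field_simps)
    show "r' i ((x N - x 1) / H) / H = aff_slope N x i * d (Suc i) - \<alpha> i * d N"
      using H r'1[OF i] unfolding aff_slope_def H_def[symmetric] by (simp add: field_simps)
  qed
  then obtain f where C1: "C1_within {x 1..x N} f" and ends: "f (x 1) = y 1" "f (x N) = y N"
    and eq: "\<And>i t. i \<in> {1..N-1} \<Longrightarrow> t \<in> {x 1..x N} \<Longrightarrow> f (aff_map N x i t) = \<alpha> i * f t + R i t"
    by blast
  have "is_rcsfif N x y d \<alpha> u v f"
    unfolding is_rcsfif_def Let_def
    using assms C1_within_imp_continuous_on[OF C1] ends eq unfolding R_def H_def by blast
  with C1 show ?thesis by blast
qed

text \<open>Restricting any solution to the interval gives an extensional solution, and uniqueness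
  on the interval makes it the only one. So the definite description is resolved by whichever
  solution is at hand.\<close>

lemma rcsfif_eqI:
  assumes f: "is_rcsfif N x y d \<alpha> u v f" and t: "t \<in> {x 1..x N}"
  shows "rcsfif N x y d \<alpha> u v t = f t"
proof -
  have "rcsfif N x y d \<alpha> u v = restrict f {x 1..x N}"
    unfolding rcsfif_def
  proof (rule the_equality)
    show "restrict f {x 1..x N} \<in> extensional {x 1..x N} \<and>
        is_rcsfif N x y d \<alpha> u v (restrict f {x 1..x N})"
      using f is_rcsfif_cong[of "restrict f {x 1..x N}" f] by simp
  next
    fix g assume g: "g \<in> extensional {x 1..x N} \<and> is_rcsfif N x y d \<alpha> u v g"
    then show "g = restrict f {x 1..x N}"
      using is_rcsfif_unique[OF _ f] by (intro extensionalityI[of _ "{x 1..x N}"]) auto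
  qed
  then show ?thesis using t by simp
qed

end

theorem theorem1:
  fixes N :: nat and x y d \<alpha> u v :: "nat \<Rightarrow> real"
  assumes "N > 2"
    and "strict_mono_on {1..N} x"
    and "\<And>i. i \<in> {1..N} \<Longrightarrow> y i > 0"
    and "\<And>i. i \<in> {1..N-1} \<Longrightarrow>
           \<alpha> i \<in> {0..<Min {aff_slope N x i, y i / y 1, y (Suc i) / y N}}"
    and "\<And>i. i \<in> {1..N-1} \<Longrightarrow> u i > 0"
    and "\<And>i. i \<in> {1..N-1} \<Longrightarrow>
           v i \<ge> Max {0,
             - u i * (3 + ((x (Suc i) - x i) * d i - \<alpha> i * (x N - x 1) * d 1)
                            / (y i - \<alpha> i * y 1)),
             - u i * (3 + (- (x (Suc i) - x i) * d (Suc i) + \<alpha> i * (x N - x 1) * d N)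
                            / (y (Suc i) - \<alpha> i * y N))}"
  shows "is_rcsfif N x y d \<alpha> u v (rcsfif N x y d \<alpha> u v) \<and>
         C1_within {x 1..x N} (rcsfif N x y d \<alpha> u v) \<and>
         (\<forall>t\<in>{x 1..x N}. rcsfif N x y d \<alpha> u v t > 0)"
proof -
  interpret knots N x using assms(1,2) by unfold_locales auto
  \<comment> \<open>\<open>A\<close> and \<open>B\<close> arise by clearing the positive
    denominators \<open>y 1\<close> and \<open>y N\<close> in the bounds under the minimum.\<close>
  have \<alpha>0: "0 \<le> \<alpha> i" and \<alpha>1: "\<alpha> i < aff_slope N x i"
    and A: "\<alpha> i * y 1 < y i" and B: "\<alpha> i * y N < y (Suc i)" if i: "i \<in> {1..N-1}" for i
    using assms(4)[OF i] assms(3)[of 1] assms(3)[of N] assms(1) by (auto simp: pos_less_divide_eq)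
  have v0: "0 \<le> v i"
    and v1: "v i \<ge> - u i * (3 + ((x (Suc i) - x i) * d i - \<alpha> i * (x N - x 1) * d 1)
                            / (y i - \<alpha> i * y 1))"
    and v2: "v i \<ge> - u i * (3 + (- (x (Suc i) - x i) * d (Suc i) + \<alpha> i * (x N - x 1) * d N)
                            / (y (Suc i) - \<alpha> i * y N))" if i: "i \<in> {1..N-1}" for i
    using assms(6)[OF i] by simp_all
  obtain f where f: "is_rcsfif N x y d \<alpha> u v f" and C1: "C1_within {x 1..x N} f"
    using C1_rcsfif_exists[of \<alpha> u v y d] \<alpha>0 \<alpha>1 assms(5) v0 by auto
  \<comment> \<open>Positivity is shown for the constructed solution \<open>f\<close> and then
    transferred to \<open>rcsfif\<close> together with the other two claims.\<close>
  have "0 < f t" if t: "t \<in> {x 1..x N}" for t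
  proof (rule functional_equation_pos[OF _ _ _ _ t])
    fix i assume i: "i \<in> {1..N-1}"
    show "0 \<le> \<alpha> i \<and> \<alpha> i < 1" using \<alpha>0[OF i] \<alpha>1[OF i] slope_le_1[OF i] by simp
    fix s assume s: "s \<in> {x 1..x N}"
    let ?\<theta> = "(s - x 1) / (x N - x 1)"
    show "0 < rc_num N x y d \<alpha> u v i ?\<theta> / rc_den u v i ?\<theta>"
    proof (rule divide_pos_pos)
      show "0 < rc_num N x y d \<alpha> u v i ?\<theta>"
        by (rule rc_num_pos) (rule assms(5) A B v1 v2 param_mem i s)+
      show "0 < rc_den u v i ?\<theta>"
        by (rule rc_den_pos) (rule assms(5) v0 param_mem i s)+
    qed
  qed (use f in \<open>auto simp: is_rcsfif_def Let_def\<close>)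
  then show ?thesis
    using f C1 rcsfif_eqI[OF f] is_rcsfif_cong[of "rcsfif N x y d \<alpha> u v" f]
      C1_within_cong[of "{x 1..x N}" "rcsfif N x y d \<alpha> u v" f] by simp
qed

end
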